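(* For every integer $n \ge 2$, there exists a convex shape $K_n$ in the plane such that any $n$ extreme points of $K_n$ can be connected by a path of length less than $\frac12 \operatorname{per} K_n$.
   Context: A convex shape is a compact convex subset of the Euclidean plane $\mathbb{R}^2$ with non-empty interior. $\operatorname{per} K$ denotes the perimeter of $K$, i.e. the length of its boundary curve. A point of a convex shape $K$ is called extreme if it does not belong to any open line segment with endpoints in $K$. All paths are continuous rectifiable curves in the plane; a path connects given points if its image contains all of them, in any order. By convention, the $n$ extreme points are not required to be distinct. *)

theory Defs
  imports "HOL-Complex_Analysis.Contour_Integration"
begin

definition convex_shape :: "(real^2) set \<Rightarrow> bool" where
  "convex_shape K \<longleftrightarrow> compact K \<and> convex K \<and> interior K \<noteq> {}"

definition subdivision :: "nat \<Rightarrow> (nat \<Rightarrow> real) \<Rightarrow> bool" where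
  "subdivision m t \<longleftrightarrow> t 0 = 0 \<and> t m = 1 \<and> mono_on {..m} t"

text \<open>Arc length on the unit interval, the parameter domain of the library's paths;
  it is infinite for non-rectifiable curves.\<close>

definition path_length :: "(real \<Rightarrow> 'a::metric_space) \<Rightarrow> ennreal" where
  "path_length g =
     (SUP (m, t) \<in> {(m, t). subdivision m t}. \<Sum>i<m. ennreal (dist (g (t i)) (g (t (Suc i)))))"

definition rectifiable_path :: "(real \<Rightarrow> 'a::metric_space) \<Rightarrow> bool" where
  "rectifiable_path g \<longleftrightarrow> path g \<and> path_length g < \<infinity>"

definition boundary_curve :: "(real \<Rightarrow> real^2) \<Rightarrow> (real^2) set \<Rightarrow> bool" where
  "boundary_curve g K \<longleftrightarrow>
     simple_path g \<and> pathfinish g = pathstart g \<and> path_image g = frontier K"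

text \<open>All simple closed parametrizations of the same curve have the same length, so the
  choice is immaterial. For convex shapes a boundary curve exists, as shown below.\<close>

definition perimeter :: "(real^2) set \<Rightarrow> ennreal" where
  "perimeter K = path_length (SOME g. boundary_curve g K)"

lemma convex_shape_boundary_curve:
  assumes "convex_shape K"
  shows "\<exists>g. boundary_curve g K"
proof -
  have K: "convex K" "bounded K" "interior K \<noteq> {}"
    using assms by (auto simp: convex_shape_def compact_imp_bounded)
  have aff: "aff_dim (cball (0::complex) 1) = aff_dim K"
    using K(3) by (simp add: aff_dim_nonempty_interior)
  have "rel_frontier (cball (0::complex) 1) homeomorphic rel_frontier K"
    by (rule homeomorphic_rel_frontiers_convex_bounded_sets) (use K aff in auto)
  moreover have "rel_frontier K = frontier K"
    using K(3) by (rule rel_frontier_nonempty_interior)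
  ultimately have "sphere (0::complex) 1 homeomorphic frontier K"
    by (simp add: rel_frontier_nonempty_interior)
  then obtain p q where pq: "homeomorphism (sphere (0::complex) 1) (frontier K) p q"
    by (auto simp: homeomorphic_def)
  define c where "c = circlepath (0::complex) 1"
  have c: "simple_path c" "pathfinish c = pathstart c" "path_image c = sphere 0 1"
    by (simp_all add: c_def simple_path_circlepath)
  have "simple_path (p \<circ> c)"
    using pq c by (intro simple_path_continuous_image)
      (auto simp: homeomorphism_def intro: inj_on_inverseI)
  moreover have "pathfinish (p \<circ> c) = pathstart (p \<circ> c)"
    using c(2) by (simp add: pathfinish_compose pathstart_compose)
  moreover have "path_image (p \<circ> c) = frontier K"
    using pq c(3) by (simp add: path_image_compose homeomorphism_def)
  ultimately show ?thesis
    unfolding boundary_curve_def by blast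
qed

end

theory Submission
  imports Defs
begin

text \<open>
  The shape is a thin polygon inscribed in the arc \<open>u \<mapsto> (u\<^sup>2, e u)\<close>, \<open>0 \<le> u \<le> 1\<close>, of a flat
  parabola.  For \<open>0 \<le> s < t\<close> compare the length of the chord from \<open>s\<close> to \<open>t\<close> with its horizontal
  extent \<open>t\<^sup>2 - s\<^sup>2\<close>.  The excess is about \<open>e\<^sup>2 (t - s) / (2 (t + s))\<close>, and it obeys two bounds that do
  not depend on the scale at which the chord lies:

  \<^item> it is never more than \<open>e\<^sup>2 / 2\<close> (\<open>dist_parabola_point_le\<close>);
  \<^item> it is at least \<open>e\<^sup>2 / 8\<close> if \<open>s = t / 2\<close> and \<open>t \<ge> e\<close> (\<open>dist_parabola_point_halving_ge\<close>).

  A path through \<open>n\<close> points of the arc, visited in the order of their parameters, consists of \<open>n - 1\<close>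
  chords, and its horizontal extent is at most 1.  So its length is at most \<open>1 + (n - 1) e\<^sup>2 / 2\<close>, however
  the points are chosen (\<open>path_through_parabola_points\<close>).  The polygon with the vertices of parameter
  \<open>1, 1/2, 1/4, \<dots>, 2\<^sup>-\<^sup>N = e\<close> and \<open>0\<close>, on the other hand, has \<open>N\<close> edges that halve the parameter, so that the
  curved side is longer than 1 by at least \<open>N e\<^sup>2 / 8\<close>, while the closing edge is longer than 1.  Half of
  the perimeter is therefore at least \<open>1 + N e\<^sup>2 / 16\<close> (\<open>perimeter_dyadic_polygon_ge\<close>), which beats the
  path as soon as \<open>N = 8 n\<close>.  In other words, \<open>\<integral> y'\<^sup>2 dx\<close> diverges logarithmically for \<open>y = \<surd>x\<close>, but
  a chord sees only a bounded part of it.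

  The perimeter is the length of an unknown simple closed parametrization of the boundary.  Such a
  curve runs through any connected part of its image that avoids the base point during one
  stretch of time (\<open>simple_path_between_connected\<close>).  Hence the curve is at least as long as the
  sum of any pairwise disjoint segments in its image (\<open>sum_segments_le_path_length\<close>), in whichever
  order and direction it traverses them.
\<close>

section \<open>Length of paths\<close>

lemma subdivision_sum_le_path_length:
  assumes "subdivision m t"
  shows "(\<Sum>i<m. ennreal (dist (g (t i)) (g (t (Suc i))))) \<le> path_length g"
  unfolding path_length_def by (rule SUP_upper2[of "(m, t)"]) (use assms in auto)

lemma path_length_linepath_le: "path_length (linepath a b) \<le> ennreal (dist a b)"
  for a b :: "'a::real_normed_vector"
  unfolding path_length_def
proof (rule SUP_least, clarify)
  fix m t assume t: "subdivision m t"
  have mono: "t i \<le> t (Suc i)" if "i < m" for i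
    using t that by (auto simp: subdivision_def intro: mono_onD)
  have "dist (linepath a b (t i)) (linepath a b (t (Suc i))) = (t (Suc i) - t i) * dist a b"
    if "i < m" for i
  proof -
    have "linepath a b (t i) - linepath a b (t (Suc i)) = (t (Suc i) - t i) *\<^sub>R (a - b)"
      by (simp add: linepath_def algebra_simps)
    then show ?thesis using mono[OF that] by (simp add: dist_norm)
  qed
  then have "(\<Sum>i<m. ennreal (dist (linepath a b (t i)) (linepath a b (t (Suc i)))))
      = ennreal (\<Sum>i<m. (t (Suc i) - t i) * dist a b)"
    using mono by (subst sum_ennreal[symmetric]) auto
  also have "(\<Sum>i<m. (t (Suc i) - t i) * dist a b) = dist a b"
    using t by (simp add: sum_distrib_right[symmetric] sum_lessThan_telescope subdivision_def)
  finally show "(\<Sum>i<m. ennreal (dist (linepath a b (t i)) (linepath a b (t (Suc i)))))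
      \<le> ennreal (dist a b)" by simp
qed

text \<open>A subdivision of the joined path is clipped to each half of the parameter interval.  The clipped
  sequences are subdivisions with the same number of points, and only the step across the junction
  needs the triangle inequality.\<close>

lemma path_length_join_le:
  assumes "pathfinish g = pathstart h"
  shows "path_length (g +++ h) \<le> path_length g + path_length h"
  unfolding path_length_def[of "g +++ h"]
proof (rule SUP_least, clarify)
  fix m t assume t: "subdivision m t"
  define u where "u i = min 1 (2 * t i)" for i
  define v where "v i = max 0 (2 * t i - 1)" for i
  have mono: "t i \<le> t j" if "i \<le> j" "j \<le> m" for i j
    using t that by (auto simp: subdivision_def intro: mono_onD)
  have u: "subdivision m u"
    using t mono unfolding subdivision_def u_def by (auto intro!: mono_onI min.mono)
  have v: "subdivision m v"
    using t mono unfolding subdivision_def v_def by (auto intro!: mono_onI max.mono)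
  have gh: "g 1 = h 0" using assms by (simp add: pathfinish_def pathstart_def)
  have step: "dist ((g +++ h) (t i)) ((g +++ h) (t (Suc i)))
      \<le> dist (g (u i)) (g (u (Suc i))) + dist (h (v i)) (h (v (Suc i)))" if "i < m" for i
  proof -
    have le: "t i \<le> t (Suc i)" using mono that by simp
    consider "t (Suc i) \<le> 1/2" | "t i \<le> 1/2" "1/2 < t (Suc i)" | "1/2 < t i" by linarith
    then show ?thesis
    proof cases
      case 1 then show ?thesis using le by (simp add: joinpaths_def u_def v_def)
    next
      case 2 then show ?thesis using gh
        by (simp add: joinpaths_def u_def v_def dist_triangle)
    next
      case 3 then show ?thesis using le by (simp add: joinpaths_def u_def v_def)
    qed
  qed
  have "(\<Sum>i<m. ennreal (dist ((g +++ h) (t i)) ((g +++ h) (t (Suc i)))))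
      \<le> (\<Sum>i<m. ennreal (dist (g (u i)) (g (u (Suc i)))) + ennreal (dist (h (v i)) (h (v (Suc i)))))"
    using step by (intro sum_mono) (simp add: ennreal_leI flip: ennreal_plus)
  also have "\<dots> = (\<Sum>i<m. ennreal (dist (g (u i)) (g (u (Suc i)))))
      + (\<Sum>i<m. ennreal (dist (h (v i)) (h (v (Suc i)))))"
    by (rule sum.distrib)
  also have "\<dots> \<le> path_length g + path_length h"
    by (intro add_mono subdivision_sum_le_path_length u v)
  finally show "(\<Sum>i<m. ennreal (dist ((g +++ h) (t i)) ((g +++ h) (t (Suc i)))))
      \<le> path_length g + path_length h" .
qed

text \<open>Disjoint intervals are ordered by their right end points, so their end points can be appended one
  interval after another to a single subdivision.\<close>

lemma sum_disjoint_intervals_le_path_length: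
  fixes g :: "real \<Rightarrow> 'a::metric_space" and a b :: "'i \<Rightarrow> real"
  assumes "finite J"
    and "\<And>j. j \<in> J \<Longrightarrow> 0 \<le> a j \<and> a j \<le> b j \<and> b j \<le> 1"
    and "\<And>i j. i \<in> J \<Longrightarrow> j \<in> J \<Longrightarrow> i \<noteq> j \<Longrightarrow> {a i..b i} \<inter> {a j..b j} = {}"
  shows "ennreal (\<Sum>j\<in>J. dist (g (a j)) (g (b j))) \<le> path_length g"
proof -
  \<comment> \<open>The last time of the partial subdivision is recorded, because the next interval starts after it.\<close>
  have "\<exists>m t. t 0 = 0 \<and> mono_on {..m} t \<and> (t m = 0 \<or> (\<exists>j\<in>J. t m = b j)) \<and>
     (\<Sum>j\<in>J. dist (g (a j)) (g (b j))) \<le> (\<Sum>i<m. dist (g (t i)) (g (t (Suc i))))"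
    using assms
  proof (induction J rule: finite_ranking_induct[where f = b])
    case empty
    show ?case by (intro exI[of _ 0] exI[of _ "\<lambda>_. 0"]) (simp add: monotone_on_def)
  next
    case (insert x J)
    show ?case
    proof (cases "x \<in> J")
      case True
      then have eq: "insert x J = J" by (rule insert_absorb)
      show ?thesis unfolding eq by (rule insert.IH[OF insert.prems[unfolded eq]])
    next
      case False
      obtain m t where t: "t 0 = 0" "mono_on {..m} t" "t m = 0 \<or> (\<exists>j\<in>J. t m = b j)"
        "(\<Sum>j\<in>J. dist (g (a j)) (g (b j))) \<le> (\<Sum>i<m. dist (g (t i)) (g (t (Suc i))))"
        using insert.IH[OF insert.prems(1)[OF insertI2] insert.prems(2)[OF insertI2 insertI2]]
        by blast
      have "t m \<le> a x"
      proof (rule ccontr)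
        assume neg: "\<not> t m \<le> a x"
        then obtain j where j: "j \<in> J" "t m = b j"
          using t(3) insert.prems(1)[of x] by auto
        then have "b j \<le> b x" "a j \<le> b j"
          using insert.hyps(2)[OF j(1)] insert.prems(1)[of j] by simp_all
        then have "b j \<in> {a x..b x} \<inter> {a j..b j}" using neg j(2) by simp
        moreover have "{a x..b x} \<inter> {a j..b j} = {}"
          by (rule insert.prems(2)) (use j(1) False in blast)+
        ultimately show False by blast
      qed
      define s where "s i = (if i \<le> m then t i else if i = Suc m then a x else b x)" for i
      have "mono_on {..Suc (Suc m)} s"
      proof (rule mono_onI)
        fix i k assume ik: "i \<in> {..Suc (Suc m)}" "k \<in> {..Suc (Suc m)}" "i \<le> k"
        have "t i \<le> t k" if "k \<le> m" using ik that t(2) by (auto intro: mono_onD)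
        moreover have "t i \<le> t m" if "i \<le> m" using that t(2) by (auto intro: mono_onD)
        moreover have "a x \<le> b x" using insert.prems(1)[of x] by simp
        moreover have "i \<le> m" if "k \<le> m" using ik that by simp
        ultimately show "s i \<le> s k"
          using ik \<open>t m \<le> a x\<close> unfolding s_def
          by (cases "k \<le> m"; cases "i \<le> m"; cases "k = Suc m"; cases "i = Suc m"; simp)
      qed
      moreover have "(\<Sum>j\<in>insert x J. dist (g (a j)) (g (b j)))
          \<le> (\<Sum>i<Suc (Suc m). dist (g (s i)) (g (s (Suc i))))"
      proof -
        have "(\<Sum>i<m. dist (g (s i)) (g (s (Suc i)))) = (\<Sum>i<m. dist (g (t i)) (g (t (Suc i))))"
          by (intro sum.cong) (auto simp: s_def)
        then show ?thesis using t(4) False insert.hyps(1)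
          by (simp add: s_def add_increasing2)
      qed
      moreover have "s 0 = 0" "s (Suc (Suc m)) = b x" using t(1) by (simp_all add: s_def)
      ultimately show ?thesis by blast
    qed
  qed
  then obtain m t where t: "t 0 = 0" "mono_on {..m} t" "t m = 0 \<or> (\<exists>j\<in>J. t m = b j)"
    "(\<Sum>j\<in>J. dist (g (a j)) (g (b j))) \<le> (\<Sum>i<m. dist (g (t i)) (g (t (Suc i))))" by blast
  define s where "s i = (if i \<le> m then t i else 1)" for i
  have "t m \<le> 1" using t(3) assms(2) by auto
  have "mono_on {..Suc m} s"
  proof (rule mono_onI)
    fix i k assume ik: "i \<in> {..Suc m}" "k \<in> {..Suc m}" "i \<le> k"
    have "t i \<le> t k" if "k \<le> m" using ik that t(2) by (auto intro: mono_onD)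
    moreover have "t i \<le> t m" if "i \<le> m" using that t(2) by (auto intro: mono_onD)
    ultimately show "s i \<le> s k" using ik \<open>t m \<le> 1\<close> unfolding s_def
      by (cases "k \<le> m"; cases "i \<le> m"; simp)
  qed
  then have sub: "subdivision (Suc m) s" using t(1) by (simp add: subdivision_def s_def)
  have "(\<Sum>i<m. dist (g (t i)) (g (t (Suc i)))) = (\<Sum>i<m. dist (g (s i)) (g (s (Suc i))))"
    by (intro sum.cong) (auto simp: s_def)
  also have "\<dots> \<le> (\<Sum>i<Suc m. dist (g (s i)) (g (s (Suc i))))" by simp
  finally have "ennreal (\<Sum>j\<in>J. dist (g (a j)) (g (b j)))
      \<le> ennreal (\<Sum>i<Suc m. dist (g (s i)) (g (s (Suc i))))"
    using t(4) by (intro ennreal_leI) linarith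
  also have "\<dots> = (\<Sum>i<Suc m. ennreal (dist (g (s i)) (g (s (Suc i)))))"
    by (rule sum_ennreal[symmetric]) simp
  also have "\<dots> \<le> path_length g"
    by (rule subdivision_sum_le_path_length[OF sub])
  finally show ?thesis .
qed

section \<open>Lower bounds for the length of a simple path\<close>

text \<open>If the curve left \<open>S\<close> at a time \<open>s\<close> between \<open>a\<close> and \<open>b\<close>, the images of \<open>[0, s]\<close> and \<open>[s, 1]\<close> would
  separate \<open>S\<close>: they are closed, and by injectivity they share only \<open>g 0\<close> and \<open>g s\<close>.  The base
  point has to be excluded, since a closed curve traverses a set around it at both ends of the time interval.\<close>

lemma simple_path_between_connected:
  fixes g :: "real \<Rightarrow> 'a::t2_space"
  assumes g: "simple_path g"
    and S: "connected S" "S \<subseteq> path_image g" "g 0 \<notin> S"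
    and ab: "0 \<le> a" "b \<le> 1" "g a \<in> S" "g b \<in> S" and s: "a \<le> s" "s \<le> b"
  shows "g s \<in> S"
proof (rule ccontr)
  assume ns: "g s \<notin> S"
  have cont: "continuous_on {0..1} g" using g by (simp add: simple_path_def path_def)
  have closed: "closed (g ` {c..d})" if "0 \<le> c" "d \<le> 1" for c d
    using that by (intro compact_imp_closed compact_continuous_image continuous_on_subset[OF cont]) auto
  have "g ` {0..s} \<inter> g ` {s..1} \<inter> S = {}"
  proof (rule ccontr)
    assume "\<not> ?thesis"
    then obtain c d where cd: "0 \<le> c" "c \<le> s" "s \<le> d" "d \<le> 1" "g c = g d" "g c \<in> S" by auto
    then have "c \<noteq> d" using ns by (metis order_antisym)
    then have "c = 0 \<and> d = 1"
      using g cd s ab unfolding simple_path_def loop_free_def by fastforce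
    then show False using cd S(3) by simp
  qed
  moreover have "S \<subseteq> g ` {0..s} \<union> g ` {s..1}"
  proof -
    have "{0..1} = {0..s} \<union> {s..1}" using s ab by auto
    then show ?thesis using S(2) by (metis path_image_def image_Un)
  qed
  moreover have "closed (g ` {0..s})" "closed (g ` {s..1})" using closed s ab by auto
  ultimately have "g ` {0..s} \<inter> S = {} \<or> g ` {s..1} \<inter> S = {}"
    by (intro connected_closedD[OF S(1)])
  moreover have "g a \<in> g ` {0..s}" "g b \<in> g ` {s..1}" using ab s by auto
  ultimately show False using ab by blast
qed

lemma sum_dist_connected_le_path_length:
  fixes g :: "real \<Rightarrow> 'a::metric_space" and p q :: "'i \<Rightarrow> 'a"
  assumes g: "simple_path g" and J: "finite J"
    and S: "\<And>j. j \<in> J \<Longrightarrow> connected (S j) \<and> S j \<subseteq> path_image g \<and> g 0 \<notin> S j"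
    and disj: "\<And>i j. i \<in> J \<Longrightarrow> j \<in> J \<Longrightarrow> i \<noteq> j \<Longrightarrow> S i \<inter> S j = {}"
    and pq: "\<And>j. j \<in> J \<Longrightarrow> p j \<in> S j \<and> q j \<in> S j"
  shows "ennreal (\<Sum>j\<in>J. dist (p j) (q j)) \<le> path_length g"
proof -
  \<comment> \<open>The curve may meet \<open>q j\<close> before \<open>p j\<close>, hence the unordered pair.\<close>
  have "\<exists>a b. 0 \<le> a \<and> a \<le> b \<and> b \<le> 1 \<and> {g a, g b} = {p j, q j}" if j: "j \<in> J" for j
  proof -
    have "p j \<in> g ` {0..1}" "q j \<in> g ` {0..1}"
      using S[OF j] pq[OF j] unfolding path_image_def by auto
    then obtain c d where cd: "c \<in> {0..1}" "d \<in> {0..1}" "p j = g c" "q j = g d" by auto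
    then show ?thesis
      by (intro exI[of _ "min c d"] exI[of _ "max c d"]) (auto simp: min_def max_def)
  qed
  then obtain a b where ab: "\<And>j. j \<in> J \<Longrightarrow> 0 \<le> a j \<and> a j \<le> b j \<and> b j \<le> 1"
    and eq: "\<And>j. j \<in> J \<Longrightarrow> {g (a j), g (b j)} = {p j, q j}" by metis
  have inS: "g s \<in> S j" if "j \<in> J" "s \<in> {a j..b j}" for j s
    using simple_path_between_connected[OF g, of "S j" "a j" "b j" s] S[OF that(1)]
      ab[OF that(1)] eq[OF that(1)] pq[OF that(1)] that(2)
    by (auto simp: doubleton_eq_iff)
  have "{a i..b i} \<inter> {a j..b j} = {}" if "i \<in> J" "j \<in> J" "i \<noteq> j" for i j
    using inS[OF that(1)] inS[OF that(2)] disj[OF that] by blast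
  then have "ennreal (\<Sum>j\<in>J. dist (g (a j)) (g (b j))) \<le> path_length g"
    using J ab by (intro sum_disjoint_intervals_le_path_length)
  moreover have "dist (g (a j)) (g (b j)) = dist (p j) (q j)" if "j \<in> J" for j
    using eq[OF that] by (auto simp: doubleton_eq_iff dist_commute)
  ultimately show ?thesis by simp
qed

text \<open>Neighbouring edges of a polygon share end points, so that only the open segments are disjoint, and
  these lack the points whose distance is wanted.  Each is therefore shrunk towards its midpoint by a factor \<open>c < 1\<close>, and \<open>c\<close> tends to 1.\<close>

lemma sum_segments_avoiding_start_le_path_length:
  fixes g :: "real \<Rightarrow> 'a::real_normed_vector" and p q :: "'i \<Rightarrow> 'a"
  assumes g: "simple_path g" and J: "finite J"
    and seg: "\<And>j. j \<in> J \<Longrightarrow> p j \<noteq> q j \<and> open_segment (p j) (q j) \<subseteq> path_image g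
        \<and> g 0 \<notin> open_segment (p j) (q j)"
    and disj: "\<And>i j. i \<in> J \<Longrightarrow> j \<in> J \<Longrightarrow> i \<noteq> j
        \<Longrightarrow> open_segment (p i) (q i) \<inter> open_segment (p j) (q j) = {}"
  shows "ennreal (\<Sum>j\<in>J. dist (p j) (q j)) \<le> path_length g"
proof (cases "path_length g")
  case (real l)
  have "c * (\<Sum>j\<in>J. dist (p j) (q j)) \<le> l" if c: "0 < c" "c < 1" for c
  proof -
    define p' where "p' j = (1 - (1 - c) / 2) *\<^sub>R p j + ((1 - c) / 2) *\<^sub>R q j" for j
    define q' where "q' j = (1 - (1 + c) / 2) *\<^sub>R p j + ((1 + c) / 2) *\<^sub>R q j" for j
    have in_seg: "p' j \<in> open_segment (p j) (q j) \<and> q' j \<in> open_segment (p j) (q j)"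
      if j: "j \<in> J" for j
    proof -
      have "p j \<noteq> q j" using seg[OF j] by blast
      then have "(1 - u) *\<^sub>R p j + u *\<^sub>R q j \<in> open_segment (p j) (q j)"
        if "0 < u" "u < 1" for u using that by (auto simp only: in_segment)
      then show ?thesis using c unfolding p'_def q'_def by simp
    qed
    have "dist (p' j) (q' j) = c * dist (p j) (q j)" for j
    proof -
      have diff: "((1 - u) *\<^sub>R p j + u *\<^sub>R q j) - ((1 - w) *\<^sub>R p j + w *\<^sub>R q j)
          = (w - u) *\<^sub>R (p j - q j)" for u w
        by (simp add: algebra_simps)
      have "(1 + c) / 2 - (1 - c) / 2 = c" by (simp add: field_simps)
      then have "p' j - q' j = c *\<^sub>R (p j - q j)"
        unfolding p'_def q'_def diff by simp
      then show ?thesis using c by (simp add: dist_norm)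
    qed
    moreover have "ennreal (\<Sum>j\<in>J. dist (p' j) (q' j)) \<le> path_length g"
    proof (rule sum_dist_connected_le_path_length[OF g J, where S = "\<lambda>j. open_segment (p j) (q j)"])
      fix j assume j: "j \<in> J"
      show "connected (open_segment (p j) (q j)) \<and> open_segment (p j) (q j) \<subseteq> path_image g
          \<and> g 0 \<notin> open_segment (p j) (q j)"
        using seg[OF j] by (simp add: convex_connected)
      show "p' j \<in> open_segment (p j) (q j) \<and> q' j \<in> open_segment (p j) (q j)"
        by (rule in_seg[OF j])
    next
      fix i j assume "i \<in> J" "j \<in> J" "i \<noteq> j"
      then show "open_segment (p i) (q i) \<inter> open_segment (p j) (q j) = {}" by (rule disj)
    qed
    ultimately have "ennreal (c * (\<Sum>j\<in>J. dist (p j) (q j))) \<le> ennreal l"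
      by (simp only: sum_distrib_left real)
    then show ?thesis using real(1) by (simp only: ennreal_le_iff)
  qed
  then have "(\<Sum>j\<in>J. dist (p j) (q j)) \<le> l" by (rule field_le_mult_one_interval)
  then show ?thesis using real by (simp add: ennreal_leI)
qed simp

text \<open>The base point lies in at most one of the segments.  That one is cut there; cutting all the others
  at their midpoints keeps the treatment uniform.\<close>

lemma sum_segments_le_path_length:
  fixes g :: "real \<Rightarrow> 'a::euclidean_space" and p q :: "'i \<Rightarrow> 'a"
  assumes g: "simple_path g" and J: "finite J"
    and seg: "\<And>j. j \<in> J \<Longrightarrow> p j \<noteq> q j \<and> open_segment (p j) (q j) \<subseteq> path_image g"
    and disj: "\<And>i j. i \<in> J \<Longrightarrow> j \<in> J \<Longrightarrow> i \<noteq> j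
        \<Longrightarrow> open_segment (p i) (q i) \<inter> open_segment (p j) (q j) = {}"
  shows "ennreal (\<Sum>j\<in>J. dist (p j) (q j)) \<le> path_length g"
proof -
  define r where "r j = (if g 0 \<in> open_segment (p j) (q j) then g 0 else midpoint (p j) (q j))" for j
  have r: "r j \<in> open_segment (p j) (q j)" if "j \<in> J" for j
    using seg[OF that] by (simp add: r_def)
  define p' where "p' = (\<lambda>(j, first). if first then p j else r j)"
  define q' where "q' = (\<lambda>(j, first). if first then r j else q j)"
  have sub: "open_segment (p' (j, f)) (q' (j, f)) \<subseteq> open_segment (p j) (q j) - {r j}"
    if "j \<in> J" for j f
  proof -
    have "open_segment (p j) (r j) \<union> {r j} \<union> open_segment (r j) (q j) = open_segment (p j) (q j)"
      by (rule Un_open_segment[OF r[OF that]])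
    moreover have "r j \<notin> open_segment (p j) (r j)" "r j \<notin> open_segment (r j) (q j)"
      by (simp_all add: open_segment_def)
    ultimately show ?thesis unfolding p'_def q'_def by (cases f) fastforce+
  qed
  have halves: "open_segment (p j) (r j) \<inter> open_segment (r j) (q j) = {}" if "j \<in> J" for j
  proof -
    have "closed_segment (p j) (r j) \<inter> closed_segment (r j) (q j) = {r j}"
      by (rule Int_closed_segment) (simp add: open_closed_segment[OF r[OF that]])
    then show ?thesis unfolding open_segment_def by blast
  qed
  have "ennreal (\<Sum>x\<in>J \<times> UNIV. dist (p' x) (q' x)) \<le> path_length g"
  proof (rule sum_segments_avoiding_start_le_path_length[OF g])
    show "finite (J \<times> (UNIV :: bool set))" using J by simp
  next
    fix x assume x: "x \<in> J \<times> (UNIV :: bool set)"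
    then obtain j f where jf: "x = (j, f)" "j \<in> J" by auto
    have "p' x \<noteq> q' x" using r[OF jf(2)] jf by (auto simp: p'_def q'_def open_segment_def)
    moreover have "g 0 \<notin> open_segment (p' x) (q' x)"
      using sub[OF jf(2), of f] jf by (auto simp: r_def)
    ultimately show "p' x \<noteq> q' x \<and> open_segment (p' x) (q' x) \<subseteq> path_image g
        \<and> g 0 \<notin> open_segment (p' x) (q' x)"
      using sub[OF jf(2), of f] seg[OF jf(2)] jf by blast
  next
    fix x y assume xy: "x \<in> J \<times> (UNIV :: bool set)" "y \<in> J \<times> (UNIV :: bool set)" "x \<noteq> y"
    obtain i e j f where eq: "x = (i, e)" "y = (j, f)" "i \<in> J" "j \<in> J" using xy by auto
    show "open_segment (p' x) (q' x) \<inter> open_segment (p' y) (q' y) = {}"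
    proof (cases "i = j")
      case True
      then have "e = (\<not> f)" using xy eq by auto
      then show ?thesis using halves[OF eq(3)] True eq by (cases f) (auto simp: p'_def q'_def)
    next
      case False
      then show ?thesis using sub[OF eq(3), of e] sub[OF eq(4), of f] disj[OF eq(3,4)] eq by blast
    qed
  qed
  moreover have "(\<Sum>x\<in>J \<times> UNIV. dist (p' x) (q' x)) = (\<Sum>j\<in>J. \<Sum>f\<in>UNIV. dist (p' (j, f)) (q' (j, f)))"
    by (simp add: sum.cartesian_product)
  moreover have "(\<Sum>f\<in>UNIV. dist (p' (j, f)) (q' (j, f))) = dist (p j) (q j)" if "j \<in> J" for j
  proof -
    have "between (p j, q j) (r j)"
      using r[OF that] by (auto simp: between_mem_segment open_segment_def)
    then show ?thesis by (simp add: UNIV_bool p'_def q'_def between)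
  qed
  ultimately show ?thesis by simp
qed

lemma supported_segment_subset_frontier:
  fixes K :: "'a::euclidean_space set"
  assumes K: "convex K" "closed K" and a: "a \<noteq> 0" "K \<subseteq> {x. a \<bullet> x \<ge> c}"
    and pq: "p \<in> K" "q \<in> K" "a \<bullet> p = c" "a \<bullet> q = c"
  shows "open_segment p q \<subseteq> frontier K"
proof
  fix z assume z: "z \<in> open_segment p q"
  then have "z \<in> K" using K pq by (meson convex_contains_open_segment subsetD)
  moreover have "a \<bullet> z = c"
  proof -
    obtain u where "z = (1 - u) *\<^sub>R p + u *\<^sub>R q" using z by (auto simp: in_segment)
    then have "a \<bullet> z = (1 - u) * c + u * c" by (simp add: inner_add_right pq)
    then show ?thesis by (simp add: algebra_simps)
  qed
  then have "z \<notin> interior K" using interior_mono[OF a(2)] a(1) by auto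
  ultimately show "z \<in> frontier K" using K by (simp add: frontier_def)
qed

section \<open>Chords of a flat parabola\<close>

definition parabola_point :: "real \<Rightarrow> real \<Rightarrow> real^2" where
  "parabola_point e u = vector [u\<^sup>2, e * u]"

lemma parabola_point_nth [simp]:
  "parabola_point e u $ 1 = u\<^sup>2" "parabola_point e u $ 2 = e * u"
  by (simp_all add: parabola_point_def)

lemma dist_parabola_point:
  "dist (parabola_point e s) (parabola_point e t) = sqrt ((t\<^sup>2 - s\<^sup>2)\<^sup>2 + e\<^sup>2 * (t - s)\<^sup>2)"
  by (simp add: dist_vec_def L2_set_def UNIV_2 dist_real_def power2_commute
      power_mult_distrib flip: right_diff_distrib)

lemma dist_parabola_point_ge: "t\<^sup>2 - s\<^sup>2 \<le> dist (parabola_point e s) (parabola_point e t)"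
  unfolding dist_parabola_point by (rule real_le_rsqrt) simp

lemma dist_parabola_point_le:
  assumes "0 \<le> s" "s \<le> t"
  shows "dist (parabola_point e s) (parabola_point e t) \<le> t\<^sup>2 - s\<^sup>2 + e\<^sup>2 / 2"
  unfolding dist_parabola_point
proof (rule real_le_lsqrt)
  have A: "s\<^sup>2 \<le> t\<^sup>2" using assms by (intro power_mono)
  show "0 \<le> t\<^sup>2 - s\<^sup>2 + e\<^sup>2 / 2" using A zero_le_power2[of e] by linarith
  have "(t - s)\<^sup>2 \<le> (t - s) * (t + s)"
    unfolding power2_eq_square using assms by (intro mult_left_mono) auto
  also have "\<dots> = t\<^sup>2 - s\<^sup>2" by (simp add: power2_eq_square algebra_simps)
  finally have "e\<^sup>2 * (t - s)\<^sup>2 \<le> e\<^sup>2 * (t\<^sup>2 - s\<^sup>2)" by (intro mult_left_mono) auto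
  moreover have "(t\<^sup>2 - s\<^sup>2 + e\<^sup>2 / 2)\<^sup>2 = (t\<^sup>2 - s\<^sup>2)\<^sup>2 + e\<^sup>2 * (t\<^sup>2 - s\<^sup>2) + (e\<^sup>2 / 2)\<^sup>2"
    by (simp add: power2_eq_square field_simps)
  ultimately show "(t\<^sup>2 - s\<^sup>2)\<^sup>2 + e\<^sup>2 * (t - s)\<^sup>2 \<le> (t\<^sup>2 - s\<^sup>2 + e\<^sup>2 / 2)\<^sup>2"
    using zero_le_power2[of "e\<^sup>2 / 2"] by linarith
qed

text \<open>For \<open>t \<ge> e\<close> the slope of the chord is at most of order 1, so that the excess over the
  horizontal extent is still comparable to its value for small slopes, which is \<open>e\<^sup>2 / 6\<close>.\<close>

lemma dist_parabola_point_halving_ge: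
  assumes "0 < e" "e \<le> t"
  shows "t\<^sup>2 - (t / 2)\<^sup>2 + e\<^sup>2 / 8 \<le> dist (parabola_point e t) (parabola_point e (t / 2))"
  unfolding dist_parabola_point
proof (rule real_le_rsqrt)
  have "e\<^sup>2 \<le> t\<^sup>2" using assms by (intro power_mono) auto
  then have "e\<^sup>2 * e\<^sup>2 \<le> e\<^sup>2 * t\<^sup>2" by (intro mult_left_mono) auto
  moreover have "0 \<le> e\<^sup>2 * t\<^sup>2" by simp
  ultimately have "e\<^sup>2 * e\<^sup>2 \<le> 4 * (e\<^sup>2 * t\<^sup>2)" by linarith
  then show "(t\<^sup>2 - (t / 2)\<^sup>2 + e\<^sup>2 / 8)\<^sup>2 \<le> ((t / 2)\<^sup>2 - t\<^sup>2)\<^sup>2 + e\<^sup>2 * (t / 2 - t)\<^sup>2"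
    by (simp add: power2_eq_square field_simps)
qed

text \<open>Joining the points in the order of their parameters makes the horizontal extents telescope, and each
  of the \<open>card U - 1\<close> chords adds at most \<open>e\<^sup>2 / 2\<close>.  This depends on the number of points only, not on
  their positions.\<close>

lemma path_through_parabola_points:
  assumes "finite U" "U \<noteq> {}" "\<And>u. u \<in> U \<Longrightarrow> 0 \<le> u"
  shows "\<exists>\<gamma>. path \<gamma> \<and> pathfinish \<gamma> = parabola_point e (Max U) \<and> parabola_point e ` U \<subseteq> path_image \<gamma>
    \<and> path_length \<gamma> \<le> ennreal ((Max U)\<^sup>2 + (real (card U) - 1) * e\<^sup>2 / 2)"
  using assms
proof (induction rule: finite_linorder_max_induct)
  case empty then show ?case by simp
next
  case (insert b U)
  have nb: "b \<notin> U" using insert.hyps by auto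
  show ?case
  proof (cases "U = {}")
    case True
    define \<kappa> where "\<kappa> = linepath (parabola_point e b) (parabola_point e b)"
    have "path \<kappa>" unfolding \<kappa>_def by (rule path_linepath)
    moreover have "pathfinish \<kappa> = parabola_point e b"
      unfolding \<kappa>_def by (rule pathfinish_linepath)
    moreover have "parabola_point e b \<in> path_image \<kappa>"
      unfolding \<kappa>_def path_image_linepath by simp
    moreover have "path_length \<kappa> \<le> ennreal (b\<^sup>2)"
      unfolding \<kappa>_def by (rule order_trans[OF path_length_linepath_le]) simp
    ultimately show ?thesis using True by (intro exI[of _ \<kappa>]) simp
  next
    case False
    then obtain \<gamma> where \<gamma>: "path \<gamma>" "pathfinish \<gamma> = parabola_point e (Max U)"
      "parabola_point e ` U \<subseteq> path_image \<gamma>"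
      "path_length \<gamma> \<le> ennreal ((Max U)\<^sup>2 + (real (card U) - 1) * e\<^sup>2 / 2)"
      using insert by auto
    have m: "Max U \<in> U" using False insert.hyps(1) by simp
    then have mb: "0 \<le> Max U" "Max U \<le> b" using insert.hyps insert.prems by (auto intro: less_imp_le)
    have maxb: "Max (insert b U) = b" using mb False insert.hyps(1) by simp
    have card: "real (card U) \<ge> 1" using False insert.hyps(1) by (simp add: Suc_le_eq card_gt_0_iff)
    define \<kappa> where "\<kappa> = linepath (parabola_point e (Max U)) (parabola_point e b)"
    have "path_length (\<gamma> +++ \<kappa>) \<le> path_length \<gamma> + path_length \<kappa>"
      by (rule path_length_join_le) (simp add: \<gamma>(2) \<kappa>_def)
    also have "\<dots> \<le> ennreal ((Max U)\<^sup>2 + (real (card U) - 1) * e\<^sup>2 / 2)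
        + ennreal (b\<^sup>2 - (Max U)\<^sup>2 + e\<^sup>2 / 2)"
      unfolding \<kappa>_def
      by (intro add_mono \<gamma>(4) order_trans[OF path_length_linepath_le] ennreal_leI
          dist_parabola_point_le mb)
    also have "\<dots> = ennreal (((Max U)\<^sup>2 + (real (card U) - 1) * e\<^sup>2 / 2) + (b\<^sup>2 - (Max U)\<^sup>2 + e\<^sup>2 / 2))"
      using mb card by (intro ennreal_plus[symmetric] add_nonneg_nonneg) (auto intro: power_mono)
    also have "((Max U)\<^sup>2 + (real (card U) - 1) * e\<^sup>2 / 2) + (b\<^sup>2 - (Max U)\<^sup>2 + e\<^sup>2 / 2)
        = (Max (insert b U))\<^sup>2 + (real (card (insert b U)) - 1) * e\<^sup>2 / 2"
      using nb insert.hyps(1) unfolding maxb by (simp add: field_simps)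
    finally show ?thesis
      using \<gamma> maxb by (intro exI[of _ "\<gamma> +++ \<kappa>"])
        (auto simp: \<kappa>_def path_image_join)
  qed
qed

section \<open>The polygon with dyadic nodes\<close>

text \<open>The last node, of index \<open>N + 1\<close>, is the apex of the parabola; the nodes decrease with the index.\<close>

definition dyadic_node :: "nat \<Rightarrow> nat \<Rightarrow> real" where
  "dyadic_node N k = (if k \<le> N then (1/2) ^ k else 0)"

text \<open>The flatness \<open>2\<^sup>-\<^sup>N\<close> equals the smallest positive node, so that every chord halving the parameter
  starts at a node \<open>t \<ge> e\<close>.\<close>

definition dyadic_vertex :: "nat \<Rightarrow> nat \<Rightarrow> real^2" where
  "dyadic_vertex N k = parabola_point ((1/2) ^ N) (dyadic_node N k)"

definition dyadic_polygon :: "nat \<Rightarrow> (real^2) set" where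
  "dyadic_polygon N = convex hull (dyadic_vertex N ` {..Suc N})"

lemma dyadic_node_bounds: "0 \<le> dyadic_node N k" "dyadic_node N k \<le> 1"
  by (simp_all add: dyadic_node_def power_le_one)

lemma dyadic_node_antimono: "i \<le> j \<Longrightarrow> dyadic_node N j \<le> dyadic_node N i"
  by (auto simp: dyadic_node_def intro: power_decreasing)

lemma dyadic_node_less: "i \<le> N \<Longrightarrow> dyadic_node N (Suc i) < dyadic_node N i"
  by (simp add: dyadic_node_def)

lemma dyadic_vertex_in_polygon: "k \<le> Suc N \<Longrightarrow> dyadic_vertex N k \<in> dyadic_polygon N"
  unfolding dyadic_polygon_def by (intro hull_inc) simp

lemma compact_dyadic_polygon: "compact (dyadic_polygon N)"
  unfolding dyadic_polygon_def by (simp add: finite_imp_compact_convex_hull)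

lemma convex_dyadic_polygon: "convex (dyadic_polygon N)"
  unfolding dyadic_polygon_def by simp

lemma dyadic_polygon_subset_halfspace:
  assumes "\<And>k. k \<le> Suc N \<Longrightarrow> a \<bullet> dyadic_vertex N k \<ge> c"
  shows "dyadic_polygon N \<subseteq> {x. a \<bullet> x \<ge> c}"
  unfolding dyadic_polygon_def
  using assms by (intro hull_minimal convex_halfspace_ge) auto

lemma convex_shape_dyadic_polygon:
  assumes "N \<ge> 1"
  shows "convex_shape (dyadic_polygon N)"
proof -
  have "interior (dyadic_polygon N) \<noteq> {}"
  proof
    assume "interior (dyadic_polygon N) = {}"
    then obtain a b where ab: "a \<noteq> 0" "dyadic_polygon N \<subseteq> {x. a \<bullet> x = b}"
      using empty_interior_subset_hyperplane[OF convex_dyadic_polygon] by metis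
    have on: "a \<bullet> dyadic_vertex N k = b" if "k \<le> Suc N" for k
      using dyadic_vertex_in_polygon[OF that] ab by auto
    have "b = 0" using on[of "Suc N"]
      by (simp add: inner_vec_def UNIV_2 dyadic_vertex_def dyadic_node_def)
    moreover have "a $ 1 + a $ 2 * (1/2) ^ N = b" using on[of 0]
      by (simp add: inner_vec_def UNIV_2 dyadic_vertex_def dyadic_node_def)
    moreover have "a $ 1 / 4 + a $ 2 * (1/2) ^ N / 2 = b" using on[of 1] assms
      by (simp add: inner_vec_def UNIV_2 dyadic_vertex_def dyadic_node_def power2_eq_square)
    ultimately have "a $ 1 = 0" "a $ 2 * (1/2) ^ N = 0" by linarith+
    then have "a = 0" by (simp add: vec_eq_iff forall_2)
    then show False using ab by simp
  qed
  then show ?thesis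
    by (simp add: convex_shape_def compact_dyadic_polygon convex_dyadic_polygon)
qed

text \<open>The line through the points with parameters \<open>s\<close> and \<open>t\<close> is a level set of the functional with
  this normal.  On the parabola the functional is the quadratic \<open>(u - s) (u - t)\<close> up to a constant, whose
  sign shows on which side of the chord the other vertices lie.\<close>

definition chord_normal :: "real \<Rightarrow> real \<Rightarrow> real \<Rightarrow> real^2" where
  "chord_normal e s t = vector [1, - (s + t) / e]"

lemma chord_normal_inner:
  "e \<noteq> 0 \<Longrightarrow> chord_normal e s t \<bullet> parabola_point e u = (u - s) * (u - t) - s * t"
  by (simp add: chord_normal_def inner_vec_def UNIV_2 power2_eq_square field_simps)

lemma chord_normal_nonzero: "chord_normal e s t \<noteq> 0"
  by (metis chord_normal_def vector_2(1) zero_index zero_neq_one)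

lemma dyadic_edge_subset_frontier:
  assumes "i \<le> N"
  shows "open_segment (dyadic_vertex N i) (dyadic_vertex N (Suc i)) \<subseteq> frontier (dyadic_polygon N)"
proof (rule supported_segment_subset_frontier[OF convex_dyadic_polygon])
  let ?s = "dyadic_node N (Suc i)" and ?t = "dyadic_node N i"
  let ?a = "chord_normal ((1/2) ^ N) ?s ?t"
  show "closed (dyadic_polygon N)" by (simp add: compact_dyadic_polygon compact_imp_closed)
  show "?a \<noteq> 0" by (rule chord_normal_nonzero)
  show "dyadic_polygon N \<subseteq> {x. ?a \<bullet> x \<ge> - ?s * ?t}"
  proof (rule dyadic_polygon_subset_halfspace)
    fix k
    have "0 \<le> (dyadic_node N k - ?s) * (dyadic_node N k - ?t)"
    proof (cases "k \<le> i")
      case True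
      then show ?thesis using dyadic_node_antimono[of k i N] dyadic_node_antimono[of k "Suc i" N]
        by (intro mult_nonneg_nonneg) auto
    next
      case False
      then show ?thesis using dyadic_node_antimono[of i k N] dyadic_node_antimono[of "Suc i" k N]
        by (intro mult_nonpos_nonpos) auto
    qed
    then show "?a \<bullet> dyadic_vertex N k \<ge> - ?s * ?t"
      by (simp add: dyadic_vertex_def chord_normal_inner)
  qed
  show "dyadic_vertex N i \<in> dyadic_polygon N" "dyadic_vertex N (Suc i) \<in> dyadic_polygon N"
    using assms by (auto intro: dyadic_vertex_in_polygon)
  show "?a \<bullet> dyadic_vertex N i = - ?s * ?t" "?a \<bullet> dyadic_vertex N (Suc i) = - ?s * ?t"
    by (simp_all add: dyadic_vertex_def chord_normal_inner)
qed

lemma dyadic_base_subset_frontier: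
  "open_segment (dyadic_vertex N (Suc N)) (dyadic_vertex N 0) \<subseteq> frontier (dyadic_polygon N)"
proof (rule supported_segment_subset_frontier[OF convex_dyadic_polygon])
  let ?a = "- chord_normal ((1/2) ^ N) 0 1"
  show "closed (dyadic_polygon N)" by (simp add: compact_dyadic_polygon compact_imp_closed)
  show "?a \<noteq> 0" by (simp add: chord_normal_nonzero)
  show "dyadic_polygon N \<subseteq> {x. ?a \<bullet> x \<ge> 0}"
  proof (rule dyadic_polygon_subset_halfspace)
    fix k
    show "?a \<bullet> dyadic_vertex N k \<ge> 0"
      using dyadic_node_bounds[of N k]
      by (simp add: dyadic_vertex_def chord_normal_inner mult_nonneg_nonpos)
  qed
  show "dyadic_vertex N (Suc N) \<in> dyadic_polygon N" "dyadic_vertex N 0 \<in> dyadic_polygon N"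
    by (auto intro: dyadic_vertex_in_polygon)
  show "?a \<bullet> dyadic_vertex N (Suc N) = 0" "?a \<bullet> dyadic_vertex N 0 = 0"
    by (simp_all add: dyadic_vertex_def chord_normal_inner dyadic_node_def)
qed

text \<open>Two edges of the curved side occupy disjoint ranges of the second coordinate.\<close>

lemma dyadic_edges_disjoint:
  assumes "i < j" "j \<le> N"
  shows "open_segment (dyadic_vertex N i) (dyadic_vertex N (Suc i))
    \<inter> open_segment (dyadic_vertex N j) (dyadic_vertex N (Suc j)) = {}"
proof -
  let ?e = "(1/2) ^ N :: real"
  have second: "?e * dyadic_node N (Suc k) < z $ 2 \<and> z $ 2 < ?e * dyadic_node N k"
    if z: "z \<in> open_segment (dyadic_vertex N k) (dyadic_vertex N (Suc k))" and "k \<le> N" for k z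
  proof -
    let ?s = "dyadic_node N (Suc k)" and ?t = "dyadic_node N k"
    obtain u where u: "0 < u" "u < 1"
      "z = (1 - u) *\<^sub>R dyadic_vertex N k + u *\<^sub>R dyadic_vertex N (Suc k)"
      using z by (auto simp: in_segment)
    have z2: "z $ 2 = ?e * ((1 - u) * ?t + u * ?s)"
      unfolding u by (simp add: dyadic_vertex_def algebra_simps)
    have st: "?s < ?t" using that by (simp add: dyadic_node_less)
    have "0 < (1 - u) * (?t - ?s)" "0 < u * (?t - ?s)" using st u by auto
    then have "?s < (1 - u) * ?t + u * ?s" "(1 - u) * ?t + u * ?s < ?t"
      by (simp_all add: algebra_simps)
    then show ?thesis unfolding z2 by simp
  qed
  have "?e * dyadic_node N j \<le> ?e * dyadic_node N (Suc i)"
    using assms by (intro mult_left_mono dyadic_node_antimono) auto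
  moreover have "i \<le> N" using assms by simp
  ultimately have "z \<notin> open_segment (dyadic_vertex N j) (dyadic_vertex N (Suc j))"
    if "z \<in> open_segment (dyadic_vertex N i) (dyadic_vertex N (Suc i))" for z
    using second[OF that] second[of z j] assms by linarith
  then show ?thesis by blast
qed

text \<open>The functional of the base is negative at every node strictly between 0 and 1.  For \<open>N \<ge> 1\<close> each
  other edge has such a node as an end point, so it stays strictly on one side of the base.  For \<open>N = 0\<close>
  the polygon degenerates to the base.\<close>

lemma dyadic_edge_disjoint_base:
  assumes "i \<le> N" "N \<ge> 1"
  shows "open_segment (dyadic_vertex N i) (dyadic_vertex N (Suc i))
    \<inter> open_segment (dyadic_vertex N (Suc N)) (dyadic_vertex N 0) = {}"
proof -
  let ?a = "chord_normal ((1/2) ^ N) 0 1"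
  have val: "?a \<bullet> dyadic_vertex N k = dyadic_node N k * (dyadic_node N k - 1)" for k
    by (simp add: dyadic_vertex_def chord_normal_inner)
  have "?a \<bullet> z = 0" if "z \<in> open_segment (dyadic_vertex N (Suc N)) (dyadic_vertex N 0)" for z
  proof -
    have "?a \<bullet> dyadic_vertex N (Suc N) = 0" "?a \<bullet> dyadic_vertex N 0 = 0"
      unfolding val by (simp_all add: dyadic_node_def)
    then show ?thesis using that by (auto simp: in_segment inner_add_right)
  qed
  moreover have "?a \<bullet> z < 0" if z: "z \<in> open_segment (dyadic_vertex N i) (dyadic_vertex N (Suc i))" for z
  proof -
    obtain u where u: "0 < u" "u < 1"
      "z = (1 - u) *\<^sub>R dyadic_vertex N i + u *\<^sub>R dyadic_vertex N (Suc i)"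
      using z by (auto simp: in_segment)
    have le: "?a \<bullet> dyadic_vertex N k \<le> 0" for k
      unfolding val using dyadic_node_bounds[of N k] by (simp add: mult_nonneg_nonpos)
    have neg: "?a \<bullet> dyadic_vertex N k < 0" if "1 \<le> k" "k \<le> N" for k
    proof -
      have "0 < dyadic_node N k" "dyadic_node N k < 1"
        using that by (auto simp: dyadic_node_def power_less_one_iff)
      then show ?thesis unfolding val by (intro mult_pos_neg) auto
    qed
    have z0: "?a \<bullet> z = (1 - u) * (?a \<bullet> dyadic_vertex N i) + u * (?a \<bullet> dyadic_vertex N (Suc i))"
      unfolding u by (simp add: inner_add_right)
    show ?thesis
    proof (cases "i = 0")
      case True
      then have "u * (?a \<bullet> dyadic_vertex N (Suc i)) < 0"
        using u neg[of 1] assms by (simp add: mult_pos_neg)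
      moreover have "(1 - u) * (?a \<bullet> dyadic_vertex N i) \<le> 0"
        using u le by (simp add: mult_nonneg_nonpos)
      ultimately show ?thesis unfolding z0 by linarith
    next
      case False
      then have "(1 - u) * (?a \<bullet> dyadic_vertex N i) < 0"
        using u neg[of i] assms by (simp add: mult_pos_neg)
      moreover have "u * (?a \<bullet> dyadic_vertex N (Suc i)) \<le> 0"
        using u le by (simp add: mult_nonneg_nonpos)
      ultimately show ?thesis unfolding z0 by linarith
    qed
  qed
  ultimately show ?thesis by fastforce
qed

lemma perimeter_dyadic_polygon_ge:
  assumes "N \<ge> 1"
  shows "ennreal (2 + N * ((1/2) ^ N)\<^sup>2 / 8) \<le> perimeter (dyadic_polygon N)"
proof -
  define e where "e = ((1/2) ^ N :: real)"
  define g where "g = (SOME g. boundary_curve g (dyadic_polygon N))"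
  have "boundary_curve g (dyadic_polygon N)"
    unfolding g_def
    using convex_shape_boundary_curve[OF convex_shape_dyadic_polygon[OF assms]] by (rule someI_ex)
  then have g: "simple_path g" "path_image g = frontier (dyadic_polygon N)"
    by (auto simp: boundary_curve_def)
  let ?v = "dyadic_vertex N"
  \<comment> \<open>Index \<open>N + 1\<close> is the base, which closes the polygon.\<close>
  define q where "q i = ?v (if i \<le> N then Suc i else 0)" for i
  have "ennreal (\<Sum>i\<le>Suc N. dist (?v i) (q i)) \<le> path_length g"
  proof (rule sum_segments_le_path_length[OF g(1)])
    fix i assume i: "i \<in> {..Suc N}"
    have "?v i $ 2 \<noteq> q i $ 2"
      using i dyadic_node_less[of i N] by (auto simp: q_def dyadic_vertex_def dyadic_node_def)
    moreover have "open_segment (?v i) (q i) \<subseteq> path_image g"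
    proof (cases "i \<le> N")
      case True
      then show ?thesis using dyadic_edge_subset_frontier[OF True] by (simp add: q_def g)
    next
      case False
      then have "i = Suc N" using i by auto
      then show ?thesis using dyadic_base_subset_frontier by (simp add: q_def g)
    qed
    ultimately show "?v i \<noteq> q i \<and> open_segment (?v i) (q i) \<subseteq> path_image g" by metis
  next
    fix i j assume ij: "i \<in> {..Suc N}" "j \<in> {..Suc N}" "i \<noteq> j"
    have *: "open_segment (?v i) (q i) \<inter> open_segment (?v j) (q j) = {}"
      if "i < j" "j \<le> Suc N" for i j
    proof (cases "j \<le> N")
      case True
      then show ?thesis using dyadic_edges_disjoint[OF that(1)] that by (simp add: q_def)
    next
      case False
      then have "j = Suc N" using that by auto
      then show ?thesis using dyadic_edge_disjoint_base[of i N] that assms by (simp add: q_def)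
    qed
    show "open_segment (?v i) (q i) \<inter> open_segment (?v j) (q j) = {}"
      using *[of i j] *[of j i] ij by (cases "i < j") (auto simp: Int_commute)
  qed simp
  \<comment> \<open>The edge from \<open>e\<close> to the apex only has to supply its horizontal extent.\<close>
  moreover have "2 + N * e\<^sup>2 / 8 \<le> (\<Sum>i\<le>Suc N. dist (?v i) (q i))"
  proof -
    let ?x = "\<lambda>i. (dyadic_node N i)\<^sup>2"
    have "(\<Sum>i<N. ?x i - ?x (Suc i) + e\<^sup>2 / 8) \<le> (\<Sum>i<N. dist (?v i) (q i))"
    proof (rule sum_mono)
      fix i assume "i \<in> {..<N}"
      then have i: "i < N" by simp
      have "e \<le> (1/2) ^ i" unfolding e_def using i by (intro power_decreasing) auto
      then show "?x i - ?x (Suc i) + e\<^sup>2 / 8 \<le> dist (?v i) (q i)"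
        using dist_parabola_point_halving_ge[of e "(1/2) ^ i"] i
        by (simp add: q_def dyadic_vertex_def dyadic_node_def e_def)
    qed
    moreover have "(\<Sum>i<N. ?x i - ?x (Suc i) + e\<^sup>2 / 8) = 1 - ?x N + N * e\<^sup>2 / 8"
    proof -
      have "(\<Sum>i<N. ?x i - ?x (Suc i)) = ?x 0 - ?x N" by (rule sum_lessThan_telescope')
      moreover have "?x 0 = 1" by (simp add: dyadic_node_def)
      ultimately show ?thesis by (simp add: sum.distrib)
    qed
    moreover have "?x N \<le> dist (?v N) (q N)"
      using dist_parabola_point_ge[of "dyadic_node N N" 0 e]
      by (simp add: q_def dyadic_vertex_def dyadic_node_def e_def dist_commute)
    moreover have "1 \<le> dist (?v (Suc N)) (q (Suc N))"
      using dist_parabola_point_ge[of 1 0 e]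
      by (simp add: q_def dyadic_vertex_def dyadic_node_def e_def)
    moreover have "(\<Sum>i\<le>Suc N. dist (?v i) (q i))
        = (\<Sum>i<N. dist (?v i) (q i)) + dist (?v N) (q N) + dist (?v (Suc N)) (q (Suc N))"
      by (simp flip: lessThan_Suc_atMost)
    ultimately show ?thesis by linarith
  qed
  ultimately show ?thesis
    unfolding perimeter_def g_def[symmetric] e_def[symmetric]
    by (meson ennreal_leI order_trans)
qed

theorem theorem3:
  fixes n :: nat
  assumes "n \<ge> 2"
  shows "\<exists>K :: (real^2) set. convex_shape K \<and>
           (\<forall>x :: nat \<Rightarrow> real^2. (\<forall>i\<in>{1..n}. x i extreme_point_of K) \<longrightarrow>
              (\<exists>\<gamma>. rectifiable_path \<gamma> \<and> (\<forall>i\<in>{1..n}. x i \<in> path_image \<gamma>) \<and>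
                   path_length \<gamma> < perimeter K / 2))"
proof -
  define N where "N = 8 * n"
  define e where "e = ((1/2) ^ N :: real)"
  have N: "N \<ge> 1" using assms by (simp add: N_def)
  have "\<exists>\<gamma>. rectifiable_path \<gamma> \<and> (\<forall>i\<in>{1..n}. x i \<in> path_image \<gamma>) \<and>
      path_length \<gamma> < perimeter (dyadic_polygon N) / 2"
    if extreme: "\<forall>i\<in>{1..n}. x i extreme_point_of dyadic_polygon N" for x
  proof -
    from extreme have "\<forall>i\<in>{1..n}. \<exists>k. x i = dyadic_vertex N k"
      unfolding dyadic_polygon_def by (blast dest: extreme_point_of_convex_hull)
    then obtain k where k: "\<And>i. i \<in> {1..n} \<Longrightarrow> x i = dyadic_vertex N (k i)" by metis
    \<comment> \<open>Repeated points collapse in \<open>U\<close>, which only lowers the bound for the path.\<close>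
    define U where "U = (\<lambda>i. dyadic_node N (k i)) ` {1..n}"
    have U: "finite U" "U \<noteq> {}" "\<And>u. u \<in> U \<Longrightarrow> 0 \<le> u" "card U \<le> n"
      using assms card_image_le[of "{1..n}" "\<lambda>i. dyadic_node N (k i)"]
      by (auto simp: U_def dyadic_node_bounds)
    obtain \<gamma> where \<gamma>: "path \<gamma>" "parabola_point e ` U \<subseteq> path_image \<gamma>"
      "path_length \<gamma> \<le> ennreal ((Max U)\<^sup>2 + (real (card U) - 1) * e\<^sup>2 / 2)"
      using path_through_parabola_points[OF U(1-3)] by blast
    have "Max U \<in> U" using U by simp
    then have "0 \<le> Max U" "Max U \<le> 1" by (auto simp: U_def dyadic_node_bounds)
    then have "(Max U)\<^sup>2 \<le> 1" by (simp add: power_le_one)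
    moreover have "(real (card U) - 1) * e\<^sup>2 / 2 < N * e\<^sup>2 / 16"
      using U(4) by (simp add: N_def e_def)
    ultimately have "(Max U)\<^sup>2 + (real (card U) - 1) * e\<^sup>2 / 2 < (2 + N * e\<^sup>2 / 8) / 2" by simp
    then have "path_length \<gamma> < ennreal ((2 + N * e\<^sup>2 / 8) / 2)"
      by (intro le_less_trans[OF \<gamma>(3)] ennreal_lessI) (auto intro: add_pos_nonneg)
    also have "\<dots> = ennreal (2 + N * e\<^sup>2 / 8) / 2"
      by (intro ennreal_divide_numeral[symmetric]) auto
    also have "\<dots> \<le> perimeter (dyadic_polygon N) / 2"
      using perimeter_dyadic_polygon_ge[OF N] unfolding e_def by (rule divide_right_mono_ennreal)
    finally have less: "path_length \<gamma> < perimeter (dyadic_polygon N) / 2" .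
    show ?thesis
    proof (intro exI conjI ballI)
      show "rectifiable_path \<gamma>"
        using \<gamma>(1) less by (auto simp: rectifiable_path_def intro: less_le_trans)
      show "path_length \<gamma> < perimeter (dyadic_polygon N) / 2" by (rule less)
      fix i assume i: "i \<in> {1..n}"
      then have "dyadic_node N (k i) \<in> U" by (simp add: U_def)
      then show "x i \<in> path_image \<gamma>"
        using \<gamma>(2) k[OF i] by (auto simp: dyadic_vertex_def e_def)
    qed
  qed
  with convex_shape_dyadic_polygon[OF N] show ?thesis by blast
qed

end
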